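(* Let $G$ be a $(4,1)$-graph (not necessarily $6$-regular). Then no $6$-edge-cut of $G$ has a shore of size $a$ with $2\le a\le 8$.
   Context: All graphs are finite and simple. A $(4,1)$-graph is a graph $G$ with $\chi(G)=4$, $\chi(G-v)=3$ for every vertex $v$, and $\chi(G-e)=4$ for every edge $e$. For a partition $V(G)=A\sqcup B$ with $A,B$ nonempty, the edge cut is the set $E(A,B)$ of edges with one end in $A$ and one in $B$; it is a $6$-edge-cut if $|E(A,B)|=6$, and $A$ and $B$ are its shores. *)

theory Defs
  imports Main
begin

text \<open>A graph is given by a vertex set \<open>V\<close> and a set \<open>E\<close> of two-element subsets of \<open>V\<close>.\<close>

definition simple_graph :: "'a set \<Rightarrow> 'a set set \<Rightarrow> bool" where
  "simple_graph V E \<longleftrightarrow> finite V \<and> (\<forall>e\<in>E. e \<subseteq> V \<and> card e = 2)"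

definition proper_coloring :: "'a set \<Rightarrow> 'a set set \<Rightarrow> nat \<Rightarrow> ('a \<Rightarrow> nat) \<Rightarrow> bool" where
  "proper_coloring V E k c \<longleftrightarrow>
     (\<forall>v\<in>V. c v < k) \<and> (\<forall>u\<in>V. \<forall>v\<in>V. {u, v} \<in> E \<longrightarrow> c u \<noteq> c v)"

definition chromatic_number :: "'a set \<Rightarrow> 'a set set \<Rightarrow> nat" where
  "chromatic_number V E = (LEAST k. \<exists>c. proper_coloring V E k c)"

text \<open>The minimum is attained, because giving all vertices distinct colors is proper.\<close>

lemma proper_coloring_exists:
  assumes "simple_graph V E"
  shows "\<exists>c. proper_coloring V E (card V) c"
proof -
  from assms have fin: "finite V" and two: "\<forall>e\<in>E. card e = 2"
    by (auto simp: simple_graph_def)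
  from ex_bij_betw_finite_nat[OF fin] obtain c where c: "bij_betw c V {0..<card V}" ..
  have "c u \<noteq> c v" if "u \<in> V" "v \<in> V" "{u, v} \<in> E" for u v
  proof
    assume "c u = c v"
    with c that have "u = v" by (auto simp: bij_betw_def inj_on_def)
    with two that(3) have "card {u} = 2" by force
    then show False by simp
  qed
  moreover have "\<forall>v\<in>V. c v < card V"
    using c by (auto simp: bij_betw_def)
  ultimately show ?thesis
    by (auto simp: proper_coloring_def)
qed

definition four_one_graph :: "'a set \<Rightarrow> 'a set set \<Rightarrow> bool" where
  "four_one_graph V E \<longleftrightarrow>
     simple_graph V E \<and>
     chromatic_number V E = 4 \<and>
     (\<forall>v\<in>V. chromatic_number (V - {v}) {e\<in>E. v \<notin> e} = 3) \<and>
     (\<forall>e\<in>E. chromatic_number V (E - {e}) = 4)"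

definition edge_cut :: "'a set set \<Rightarrow> 'a set \<Rightarrow> 'a set \<Rightarrow> 'a set set" where
  "edge_cut E A B = {e\<in>E. \<exists>a\<in>A. \<exists>b\<in>B. e = {a, b}}"

end

theory Submission
  imports Defs
begin

text \<open>
  The proof is a degree count. In a \<open>(4,1)\<close>-graph every vertex has degree at least \<open>6\<close>: given a
  3-coloring of \<open>G - v\<close>, each of the three colors occurs at least twice around \<open>v\<close>, because
  otherwise giving that color to \<open>v\<close> would color \<open>G\<close> with at most one monochromatic edge, and
  deleting that edge would leave a 3-colorable graph (lemma \<open>four_one_degree\<close>).

  Let a shore \<open>A\<close> have \<open>a\<close> vertices. A 3-coloring of \<open>G[A]\<close> splits it into classes of sizes
  \<open>p, q, r\<close>. A vertex of a class of size \<open>p\<close> has at most \<open>a - p\<close> neighbors in \<open>A\<close>, hence at least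
  \<open>6 + p - a\<close> neighbors across the cut. Summing over \<open>A\<close> gives
  \<open>p(6+p-a) + q(6+q-a) + r(6+r-a) \<le> 6\<close>, a form of Turan's bound, and for \<open>2 \<le> a \<le> 8\<close> this
  leaves only the sizes \<open>3, 3, 2\<close>, with equality everywhere (lemma \<open>class_sizes_tight\<close>). So \<open>G[A]\<close> is
  \<open>K\<^bsub>3,3,2\<^esub>\<close> and the two vertices of the class of size \<open>2\<close> have all their neighbors in \<open>A\<close>: they
  have the same neighborhood (lemma \<open>small_shore_has_twins\<close>). A vertex-critical graph has no such twins,
  since a 3-coloring of the graph without one of them extends by copying the color of the other
  (lemma \<open>four_one_no_twins\<close>).
\<close>

section \<open>Neighborhoods and edge cuts\<close>

definition nbrs :: "'a set set \<Rightarrow> 'a \<Rightarrow> 'a set" where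
  "nbrs E v = {u. {u, v} \<in> E}"

lemma nbrs_subset:
  assumes "simple_graph V E"
  shows "nbrs E v \<subseteq> V - {v}"
proof
  fix u assume "u \<in> nbrs E v"
  then have "{u, v} \<subseteq> V" "card {u, v} = 2"
    using assms by (auto simp: nbrs_def simple_graph_def)
  then show "u \<in> V - {v}" by auto
qed

lemma finite_nbrs: "simple_graph V E \<Longrightarrow> finite (nbrs E v)"
  by (rule finite_subset[OF nbrs_subset]) (auto simp: simple_graph_def)

lemma edge_cut_commute: "edge_cut E A B = edge_cut E B A"
proof -
  have "edge_cut E X Y \<subseteq> edge_cut E Y X" for X Y
  proof
    fix e assume "e \<in> edge_cut E X Y"
    then obtain a b where "e \<in> E" "a \<in> X" "b \<in> Y" "e = {a, b}"
      unfolding edge_cut_def by blast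
    moreover have "e = {b, a}" using calculation by blast
    ultimately show "e \<in> edge_cut E Y X" unfolding edge_cut_def by blast
  qed
  then show ?thesis by blast
qed

lemma card_edge_cut:
  assumes G: "simple_graph V E" and "A \<union> B = V" and "A \<inter> B = {}"
  shows "card (edge_cut E A B) = (\<Sum>v\<in>A. card (nbrs E v \<inter> B))"
proof -
  have fin: "finite A" using G assms(2) by (auto simp: simple_graph_def)
  have "bij_betw (\<lambda>(a, b). {a, b}) (SIGMA a:A. nbrs E a \<inter> B) (edge_cut E A B)"
    unfolding bij_betw_def
  proof
    show "inj_on (\<lambda>(a, b). {a, b}) (SIGMA a:A. nbrs E a \<inter> B)"
      using assms(3) by (auto simp: inj_on_def doubleton_eq_iff)
    show "(\<lambda>(a, b). {a, b}) ` (SIGMA a:A. nbrs E a \<inter> B) = edge_cut E A B"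
      unfolding edge_cut_def nbrs_def by (auto simp: image_iff insert_commute)
  qed
  then have "card (edge_cut E A B) = card (SIGMA a:A. nbrs E a \<inter> B)"
    by (simp add: bij_betw_same_card)
  also have "\<dots> = (\<Sum>v\<in>A. card (nbrs E v \<inter> B))"
    using fin finite_nbrs[OF G] by simp
  finally show ?thesis .
qed

section \<open>Degrees and twins in critical graphs\<close>

lemma chromatic_number_le: "proper_coloring V E k c \<Longrightarrow> chromatic_number V E \<le> k"
  unfolding chromatic_number_def by (blast intro: Least_le)

lemma proper_coloring_chromatic_number:
  assumes "simple_graph V E"
  shows "\<exists>c. proper_coloring V E (chromatic_number V E) c"
  unfolding chromatic_number_def
  by (rule LeastI[where P = "\<lambda>k. \<exists>c. proper_coloring V E k c"], rule proper_coloring_exists[OF assms])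

lemma four_one_coloring_delete_vertex:
  assumes "four_one_graph V E" "v \<in> V"
  shows "\<exists>c. proper_coloring (V - {v}) {e\<in>E. v \<notin> e} 3 c"
proof -
  have "simple_graph (V - {v}) {e\<in>E. v \<notin> e}"
    using assms by (auto simp: four_one_graph_def simple_graph_def)
  from proper_coloring_chromatic_number[OF this] show ?thesis
    using assms by (simp add: four_one_graph_def)
qed

text \<open>
  Allowing \<open>x\<close> to be a non-edge, when \<open>E - {x} = E\<close>, puts \<open>\<chi>(G) = 4\<close> and the absence of critical
  edges into one statement.
\<close>

lemma four_one_no_coloring_delete_edge:
  assumes "four_one_graph V E"
  shows "\<not> proper_coloring V (E - {x}) 3 c"
proof
  assume "proper_coloring V (E - {x}) 3 c"
  from chromatic_number_le[OF this] show False
    using assms by (cases "x \<in> E") (auto simp: four_one_graph_def)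
qed

text \<open>
  If \<open>i\<close> occurred at most once around \<open>v\<close>, coloring \<open>v\<close> with \<open>i\<close> would create at most one
  monochromatic edge \<open>{x, v}\<close>, and the graph without it would be 3-colored. If \<open>i\<close> does not
  occur at all, any \<open>x\<close> serves.
\<close>

lemma four_one_color_twice:
  assumes G: "four_one_graph V E" and v: "v \<in> V"
    and c: "proper_coloring (V - {v}) {e\<in>E. v \<notin> e} 3 c" and i: "i < 3"
  shows "2 \<le> card {u \<in> nbrs E v. c u = i}"
proof (rule ccontr)
  have S: "simple_graph V E" using G by (simp add: four_one_graph_def)
  have fin: "finite {u \<in> nbrs E v. c u = i}" using finite_nbrs[OF S] by simp
  assume "\<not> 2 \<le> card {u \<in> nbrs E v. c u = i}"
  then have "card {u \<in> nbrs E v. c u = i} = 0 \<or> card {u \<in> nbrs E v. c u = i} = 1" by linarith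
  then obtain x where x: "{u \<in> nbrs E v. c u = i} \<subseteq> {x}"
    using fin by (auto simp: card_1_singleton_iff)
  have "proper_coloring V (E - {{x, v}}) 3 (c(v := i))"
    unfolding proper_coloring_def
  proof (intro conjI ballI impI)
    fix u assume "u \<in> V"
    then show "(c(v := i)) u < 3" using c i by (auto simp: proper_coloring_def)
  next
    fix u w assume uw: "u \<in> V" "w \<in> V" "{u, w} \<in> E - {{x, v}}"
    have ne: "u \<noteq> w" using uw S by (auto simp: simple_graph_def)
    consider "u = v" | "w = v" | "u \<noteq> v" "w \<noteq> v" by blast
    then show "(c(v := i)) u \<noteq> (c(v := i)) w"
    proof cases
      case 1
      then have "w \<in> nbrs E v" "w \<noteq> x" using uw by (auto simp: nbrs_def insert_commute)
      then show ?thesis using x ne 1 by auto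
    next
      case 2
      then have "u \<in> nbrs E v" "u \<noteq> x" using uw by (auto simp: nbrs_def)
      then show ?thesis using x ne 2 by auto
    next
      case 3
      then show ?thesis using c uw by (auto simp: proper_coloring_def)
    qed
  qed
  then show False using four_one_no_coloring_delete_edge[OF G] by blast
qed

lemma four_one_degree:
  assumes G: "four_one_graph V E" and v: "v \<in> V"
  shows "6 \<le> card (nbrs E v)"
proof -
  have S: "simple_graph V E" using G by (simp add: four_one_graph_def)
  obtain c where c: "proper_coloring (V - {v}) {e\<in>E. v \<notin> e} 3 c"
    using four_one_coloring_delete_vertex[OF G v] by blast
  have "c ` nbrs E v \<subseteq> {..<3}"
    using c nbrs_subset[OF S] by (fastforce simp: proper_coloring_def)
  then have "card (nbrs E v) = (\<Sum>i<3. card {u \<in> nbrs E v. c u = i})"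
    using sum.group[OF finite_nbrs[OF S, of v], of "{..<3}" c "\<lambda>_. 1::nat"] by simp
  moreover have "(\<Sum>i<3::nat. 2) \<le> (\<Sum>i<3. card {u \<in> nbrs E v. c u = i})"
    by (rule sum_mono) (use four_one_color_twice[OF G v c] in auto)
  ultimately show ?thesis by simp
qed

text \<open>
  A neighbor of \<open>z\<close> is also a neighbor of its twin \<open>w\<close>, so its color differs from that of \<open>w\<close>, and
  \<open>z\<close> can be given the color of \<open>w\<close>.
\<close>

lemma four_one_no_twins:
  assumes G: "four_one_graph V E" and "z \<in> V" "w \<in> V" "z \<noteq> w"
  shows "nbrs E z \<noteq> nbrs E w"
proof
  assume eq: "nbrs E z = nbrs E w"
  have S: "simple_graph V E" using G by (simp add: four_one_graph_def)
  obtain c where c: "proper_coloring (V - {z}) {e\<in>E. z \<notin> e} 3 c"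
    using four_one_coloring_delete_vertex[OF G \<open>z \<in> V\<close>] by blast
  have w: "c u \<noteq> c w" if "u \<in> nbrs E z" for u
  proof -
    have "u \<in> V - {z}" "u \<in> nbrs E w" using that eq nbrs_subset[OF S] by auto
    then show ?thesis using c assms(2-4) by (auto simp: proper_coloring_def nbrs_def)
  qed
  have "proper_coloring V E 3 (c(z := c w))"
    unfolding proper_coloring_def
  proof (intro conjI ballI impI)
    fix u assume "u \<in> V"
    then show "(c(z := c w)) u < 3" using c assms(3,4) by (auto simp: proper_coloring_def)
  next
    fix u y assume uy: "u \<in> V" "y \<in> V" "{u, y} \<in> E"
    have ne: "u \<noteq> y" using uy S by (auto simp: simple_graph_def)
    consider "u = z" | "y = z" | "u \<noteq> z" "y \<noteq> z" by blast
    then show "(c(z := c w)) u \<noteq> (c(z := c w)) y"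
    proof cases
      case 1
      then have "y \<in> nbrs E z" using uy by (auto simp: nbrs_def insert_commute)
      from w[OF this] show ?thesis using ne 1 by auto
    next
      case 2
      then have "u \<in> nbrs E z" using uy by (auto simp: nbrs_def)
      from w[OF this] show ?thesis using ne 2 by auto
    next
      case 3
      then show ?thesis using c uy by (auto simp: proper_coloring_def)
    qed
  qed
  from chromatic_number_le[OF this] show False using G by (simp add: four_one_graph_def)
qed

section \<open>Small shores\<close>

text \<open>
  The identity \<open>3(p\<^sup>2 + q\<^sup>2 + r\<^sup>2) = a\<^sup>2 + (p-q)\<^sup>2 + (q-r)\<^sup>2 + (p-r)\<^sup>2\<close> turns the hypothesis into
  \<open>(p-q)\<^sup>2 + (q-r)\<^sup>2 + (p-r)\<^sup>2 \<le> 2(a\<^sup>2 - 9a + 9)\<close>. The right-hand side is negative for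
  \<open>2 \<le> a \<le> 7\<close> and equals \<open>2\<close> for \<open>a = 8\<close>, where it forces the three sizes to be as equal as
  possible.
\<close>

lemma class_sizes_tight:
  fixes p q r a :: int
  assumes a: "p + q + r = a" "2 \<le> a" "a \<le> 8"
    and le: "p * (6 + p - a) + q * (6 + q - a) + r * (6 + r - a) \<le> 6"
  shows "a = 8" and "p = 2 \<or> q = 2 \<or> r = 2"
    and "p * (6 + p - a) + q * (6 + q - a) + r * (6 + r - a) = 6"
proof -
  let ?D = "(p - q)\<^sup>2 + (q - r)\<^sup>2 + (p - r)\<^sup>2"
  have id: "3 * (p * (6 + p - a) + q * (6 + q - a) + r * (6 + r - a)) = ?D + 18 * a - 2 * a\<^sup>2"
    unfolding a(1)[symmetric] by (simp add: power2_eq_square algebra_simps)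
  have "?D + 18 * a - 2 * a\<^sup>2 \<le> 3 * 6"
    unfolding id[symmetric] by (rule mult_left_mono[OF le]) simp
  then have D: "?D \<le> 2 * a\<^sup>2 - 18 * a + 18" by simp
  have "0 \<le> ?D" by simp
  then have nonneg: "0 \<le> 2 * a\<^sup>2 - 18 * a + 18" using D by (rule order_trans)
  have "a \<in> {2, 3, 4, 5, 6, 7, 8}" using a(2,3) by auto
  then show a8: "a = 8" using nonneg by auto
  have "?D \<le> 2" using D a8 by simp
  then have sq: "(p - q)\<^sup>2 \<le> 2" "(q - r)\<^sup>2 \<le> 2" "(p - r)\<^sup>2 \<le> 2"
    using zero_le_power2[of "p - q"] zero_le_power2[of "q - r"] zero_le_power2[of "p - r"]
    by linarith+
  have small: "x \<le> 1 \<and> -1 \<le> x" if "x\<^sup>2 \<le> 2" for x :: int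
  proof -
    have "\<bar>x\<bar> < 2" by (rule power2_less_imp_less) (use that in auto)
    then show ?thesis by linarith
  qed
  have "p \<in> {2, 3}" "q \<in> {2, 3}" "r \<in> {2, 3}"
    using small[OF sq(1)] small[OF sq(2)] small[OF sq(3)] a(1) a8 by auto
  then have "(p = 2 \<and> q = 3 \<and> r = 3) \<or> (p = 3 \<and> q = 2 \<and> r = 3) \<or> (p = 3 \<and> q = 3 \<and> r = 2)"
    using a(1) a8 by auto
  then show "p = 2 \<or> q = 2 \<or> r = 2"
    and "p * (6 + p - a) + q * (6 + q - a) + r * (6 + r - a) = 6"
    using a8 by auto
qed

text \<open>
  The degree bound and the coloring bound the number of cut edges at each vertex from below by a
  number depending only on the size of its color class. On a small shore these bounds already add
  up to the whole cut, so they are attained. In the class of size \<open>2\<close> the bound is \<open>0\<close>, and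
  attaining it means being adjacent to exactly the six vertices of the other two classes.
\<close>

lemma small_shore_has_twins:
  assumes S: "simple_graph V E" and V: "A \<union> B = V" "A \<inter> B = {}"
    and cut: "card (edge_cut E A B) \<le> 6"
    and deg: "\<And>v. v \<in> A \<Longrightarrow> 6 \<le> card (nbrs E v)"
    and c: "proper_coloring A E 3 c"
    and size: "2 \<le> card A" "card A \<le> 8"
  obtains z w where "z \<in> A" "w \<in> A" "z \<noteq> w" "nbrs E z = nbrs E w"
proof -
  define cls where "cls i = {v \<in> A. c v = i}" for i
  define d where "d v = int (card (nbrs E v \<inter> B))" for v
  \<comment> \<open>The lower bound for \<open>d\<close> on the class \<open>cls i\<close>; it can be negative, hence the integers.\<close>
  define m where "m i = 6 + int (card (cls i)) - int (card A)" for i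
  have fin: "finite A" using S V by (auto simp: simple_graph_def)
  have sub: "nbrs E v \<inter> A \<subseteq> A - cls (c v)" if "v \<in> A" for v
    using c that by (auto simp: proper_coloring_def nbrs_def cls_def)
  have card_diff: "int (card (A - cls i)) = int (card A) - int (card (cls i))" for i
  proof -
    have "cls i \<subseteq> A" by (auto simp: cls_def)
    then show ?thesis using fin
      by (metis card_Diff_subset card_mono finite_subset of_nat_diff)
  qed
  have split: "nbrs E v = nbrs E v \<inter> A \<union> nbrs E v \<inter> B" for v
    using nbrs_subset[OF S] V by blast
  have low: "m (c v) \<le> d v" if "v \<in> A" for v
  proof -
    have "card (nbrs E v) \<le> card (nbrs E v \<inter> A) + card (nbrs E v \<inter> B)"
      using split card_Un_le by metis
    moreover have "card (nbrs E v \<inter> A) \<le> card (A - cls (c v))"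
      using sub[OF that] fin by (simp add: card_mono)
    ultimately show ?thesis
      using deg[OF that] card_diff[of "c v"] by (simp add: d_def m_def)
  qed
  have im: "c ` A \<subseteq> {..<3}" using c by (auto simp: proper_coloring_def)
  have three: "(\<Sum>i<3. f i) = f 0 + f 1 + f 2" for f :: "nat \<Rightarrow> int"
    by (simp add: numeral_3_eq_3 numeral_2_eq_2)
  have "int (card A) = (\<Sum>i<3. int (card (cls i)))"
    using sum.group[OF fin, of "{..<3}" c "\<lambda>_. 1::int"] im by (simp add: cls_def)
  then have sizes: "int (card (cls 0)) + int (card (cls 1)) + int (card (cls 2)) = int (card A)"
    by (simp add: three)
  have "(\<Sum>v\<in>A. m (c v)) = (\<Sum>i<3. \<Sum>v\<in>cls i. m (c v))"
    using sum.group[OF fin, of "{..<3}" c "\<lambda>v. m (c v)"] im by (simp add: cls_def)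
  also have "\<dots> = (\<Sum>i<3. int (card (cls i)) * m i)"
    by (rule sum.cong) (auto simp: cls_def)
  finally have total_m: "(\<Sum>v\<in>A. m (c v)) =
      int (card (cls 0)) * m 0 + int (card (cls 1)) * m 1 + int (card (cls 2)) * m 2"
    by (simp add: three)
  have total_d: "(\<Sum>v\<in>A. d v) \<le> 6"
    using cut unfolding card_edge_cut[OF S V] d_def by (simp flip: of_nat_sum)
  have "(\<Sum>v\<in>A. m (c v)) \<le> (\<Sum>v\<in>A. d v)"
    by (rule sum_mono) (rule low)
  then have le: "(\<Sum>v\<in>A. m (c v)) \<le> 6" using total_d by linarith
  have s2: "2 \<le> int (card A)" "int (card A) \<le> 8" using size by simp_all
  note tight = class_sizes_tight[OF sizes s2, folded m_def, folded total_m, OF le]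
  \<comment> \<open>Both totals equal \<open>6\<close>, so the lower bound on the cut degree is attained at each vertex.\<close>
  have "(\<Sum>v\<in>A. d v - m (c v)) \<le> 0"
    using tight(3) total_d by (simp add: sum_subtractf)
  moreover have "0 \<le> (\<Sum>v\<in>A. d v - m (c v))"
    by (rule sum_nonneg) (use low in force)
  ultimately have "(\<Sum>v\<in>A. d v - m (c v)) = 0" by linarith
  then have eq: "d v = m (c v)" if "v \<in> A" for v
    using sum_nonneg_eq_0_iff[OF fin, of "\<lambda>v. d v - m (c v)"] low that by auto
  obtain i where i: "card (cls i) = 2" using tight(2) by force
  then obtain z w where zw: "cls i = {z, w}" "z \<noteq> w" by (auto simp: card_2_iff)
  have nb: "nbrs E v = A - cls i" if "v \<in> cls i" for v
  proof -
    have v: "v \<in> A" "c v = i" using that by (auto simp: cls_def)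
    have "d v = 0" using eq[OF v(1)] v(2) i tight(1) by (simp add: m_def)
    then have "nbrs E v \<inter> B = {}" using finite_nbrs[OF S] by (simp add: d_def)
    then have "nbrs E v \<subseteq> A - cls i" using split[of v] sub[OF v(1)] v(2) by auto
    moreover have "card (A - cls i) \<le> card (nbrs E v)"
      using card_diff[of i] i tight(1) deg[OF v(1)] by linarith
    ultimately show ?thesis using fin by (simp add: card_seteq)
  qed
  show thesis
  proof (rule that)
    show "z \<in> A" "w \<in> A" using zw(1) by (auto simp: cls_def)
    show "nbrs E z = nbrs E w" using nb zw(1) by simp
  qed (rule zw(2))
qed

lemma four_one_no_small_shore:
  assumes G: "four_one_graph V E" and V: "A \<union> B = V" "A \<inter> B = {}" and "B \<noteq> {}"
    and cut: "card (edge_cut E A B) \<le> 6"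
  shows "\<not> (2 \<le> card A \<and> card A \<le> 8)"
proof
  assume size: "2 \<le> card A \<and> card A \<le> 8"
  have S: "simple_graph V E" using G by (simp add: four_one_graph_def)
  \<comment> \<open>\<open>A\<close> is a proper part of the graph, so deleting a vertex of \<open>B\<close> gives a 3-coloring of it.\<close>
  obtain b where b: "b \<in> B" using \<open>B \<noteq> {}\<close> by blast
  then obtain c where c: "proper_coloring (V - {b}) {e\<in>E. b \<notin> e} 3 c"
    using four_one_coloring_delete_vertex[OF G] V(1) by blast
  have sub: "A \<subseteq> V - {b}" using b V by blast
  have "proper_coloring A E 3 c"
    unfolding proper_coloring_def
  proof (intro conjI ballI impI)
    fix u assume "u \<in> A"
    then show "c u < 3" using c sub by (auto simp: proper_coloring_def)
  next
    fix u v assume "u \<in> A" "v \<in> A" "{u, v} \<in> E"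
    moreover have "u \<in> V - {b}" "v \<in> V - {b}" using calculation sub by auto
    ultimately show "c u \<noteq> c v" using c by (auto simp: proper_coloring_def)
  qed
  moreover have "6 \<le> card (nbrs E v)" if "v \<in> A" for v
    using four_one_degree[OF G] that V(1) by blast
  ultimately obtain z w where "z \<in> A" "w \<in> A" "z \<noteq> w" "nbrs E z = nbrs E w"
    using small_shore_has_twins[OF S V cut] size by metis
  then show False using four_one_no_twins[OF G] V(1) by blast
qed

theorem theorem5p1:
  fixes V A B :: "'a set" and E :: "'a set set"
  assumes "four_one_graph V E"
    and "A \<union> B = V" and "A \<inter> B = {}" and "A \<noteq> {}" and "B \<noteq> {}"
    and "card (edge_cut E A B) = 6"
  shows "\<forall>S\<in>{A, B}. \<not> (2 \<le> card S \<and> card S \<le> 8)"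
proof -
  have "\<not> (2 \<le> card A \<and> card A \<le> 8)"
    using four_one_no_small_shore[of V E A B] assms by simp
  moreover have "\<not> (2 \<le> card B \<and> card B \<le> 8)"
    using four_one_no_small_shore[of V E B A] assms
    by (simp add: edge_cut_commute[of E B A] Un_commute Int_commute)
  ultimately show ?thesis by simp
qed

end
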